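(* Let $\mu$ be a Borel probability measure on $\mathbb{R}^n\times\{-1,+1\}$ and let $\mathcal{X}\subseteq\mathbb{R}^n$ be the support of its marginal on $\mathbb{R}^n$. Assume that $\mu$ is linearly separable by the hyperplane in $\mathbb{R}^n$ indexed by $(w_0,b_0)\in\mathbb{R}^n\times\mathbb{R}$, i.e. $\mathbb{P}_{(\mathsf{x},\mathsf{y})\sim\mu}[\mathsf{y}(\langle w_0,\mathsf{x}\rangle+b_0)\ge 1]=1$. Let $Q\in\mathbb{R}^{m\times n}$ be $\eta$-inner-product-preserving over $\mathcal{X}$. If $\eta<\frac{1}{\|w_0\|^2}$, then $\mu$ remains linearly separable under the compression of $Q$, i.e. there exists $(w',b')\in\mathbb{R}^m\times\mathbb{R}$ such that $\mathbb{P}_{(\mathsf{x},\mathsf{y})\sim\mu}[\mathsf{y}(\langle w',Q\mathsf{x}\rangle+b')\ge 1]=1$.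
   Context: $\|\cdot\|$ is the Euclidean norm; $1/\|w_0\|^2$ is read as $+\infty$ if $w_0=0$. The support is described as follows: $\mathcal{X}^+$ is the set of $x\in\mathbb{R}^n$ such that $\mu(\mathcal{A}\times\{+1\})>0$ for every open $\mathcal{A}\subseteq\mathbb{R}^n$ containing $x$; $\mathcal{X}^-$ is defined in the same way with $-1$ in place of $+1$; and $\mathcal{X}=\mathcal{X}^+\cup\mathcal{X}^-$. For $\mathcal{A}\subseteq\mathbb{R}^n$, a matrix $Q\in\mathbb{R}^{m\times n}$ is $\eta$-inner-product-preserving over $\mathcal{A}$ if $\sup_{x,x'\in\mathcal{A}}|\langle Qx,Qx'\rangle-\langle x,x'\rangle|\le\eta$. *)

theory Defs
  imports "HOL-Probability.Probability"
begin

text \<open>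
  The Borel sigma-algebra of $\mathbb{R}^n \times \{-1,+1\}$, the label set being discrete.
  The underlying space is \<open>UNIV \<times> {-1, 1}\<close>, so a measure with these measurable sets
  lives on labelled points only.
\<close>

definition labelled_borel :: "((real ^ 'n) \<times> real) measure" where
  "labelled_borel = borel \<Otimes>\<^sub>M count_space {-1, 1}"

definition class_support :: "((real ^ 'n) \<times> real) measure \<Rightarrow> real \<Rightarrow> (real ^ 'n) set" where
  "class_support M y = {x. \<forall>A. open A \<longrightarrow> x \<in> A \<longrightarrow> measure M (A \<times> {y}) > 0}"

definition data_support :: "((real ^ 'n) \<times> real) measure \<Rightarrow> (real ^ 'n) set" where
  "data_support M = class_support M 1 \<union> class_support M (-1)"

text \<open>
  The supremum is taken in \<^typ>\<open>ereal\<close>, where it is the true supremum even if the deviations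
  are unbounded on \<open>A\<close>.
\<close>

definition inner_product_preserving ::
    "real \<Rightarrow> (real ^ 'n) set \<Rightarrow> real ^ 'n ^ 'm \<Rightarrow> bool" where
  "inner_product_preserving \<eta> A Q \<longleftrightarrow>
     (SUP (x, x') \<in> A \<times> A. ereal \<bar>(Q *v x) \<bullet> (Q *v x') - x \<bullet> x'\<bar>) \<le> ereal \<eta>"

text \<open>The union of the class supports is the topological support of the marginal.\<close>

lemma data_support_eq_marginal_support:
  fixes M :: "((real ^ 'n) \<times> real) measure"
  assumes "prob_space M" and sets: "sets M = sets labelled_borel"
  shows "data_support M = {x. \<forall>A. open A \<longrightarrow> x \<in> A \<longrightarrow> measure (distr M borel fst) A > 0}"
proof -
  interpret prob_space M by fact
  have space: "space M = UNIV \<times> {-1, 1}"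
    using sets_eq_imp_space_eq[OF sets] by (simp add: labelled_borel_def space_pair_measure)
  have fst_meas: "fst \<in> M \<rightarrow>\<^sub>M borel"
    using measurable_cong_sets[OF sets refl, of "borel :: (real ^ 'n) measure"]
    by (simp add: labelled_borel_def)
  have class_sets: "A \<times> {y} \<in> sets M" if "open A" "y \<in> {-1, 1}" for A :: "(real ^ 'n) set" and y
    using that by (auto simp: sets labelled_borel_def intro!: pair_measureI)
  have split: "measure (distr M borel fst) A = measure M (A \<times> {1}) + measure M (A \<times> {-1})"
    if "open A" for A :: "(real ^ 'n) set"
  proof -
    have "fst -` A \<inter> space M = A \<times> {1} \<union> A \<times> {-1}"
      by (auto simp: space)
    then have "measure (distr M borel fst) A = measure M (A \<times> {1} \<union> A \<times> {-1})"
      using that by (simp add: measure_distr[OF fst_meas])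
    also have "\<dots> = measure M (A \<times> {1}) + measure M (A \<times> {-1})"
      using that by (intro finite_measure_Union class_sets) auto
    finally show ?thesis .
  qed
  have pos: "measure (distr M borel fst) A > 0"
    if "open A" "measure M (A \<times> {1}) > 0 \<or> measure M (A \<times> {-1}) > 0" for A :: "(real ^ 'n) set"
    using that(2) split[OF that(1)] measure_nonneg[of M "A \<times> {1}"] measure_nonneg[of M "A \<times> {-1}"]
    by linarith
  show ?thesis
  proof (intro equalityI subsetI)
    fix x assume "x \<in> data_support M"
    then show "x \<in> {x. \<forall>A. open A \<longrightarrow> x \<in> A \<longrightarrow> measure (distr M borel fst) A > 0}"
      unfolding data_support_def class_support_def using pos by blast
  next
    fix x assume x: "x \<in> {x. \<forall>A. open A \<longrightarrow> x \<in> A \<longrightarrow> measure (distr M borel fst) A > 0}"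
    show "x \<in> data_support M"
    proof (rule ccontr)
      assume "x \<notin> data_support M"
      then obtain A B where AB: "open A" "x \<in> A" "\<not> measure M (A \<times> {1}) > 0"
        "open B" "x \<in> B" "\<not> measure M (B \<times> {-1}) > 0"
        unfolding data_support_def class_support_def by blast
      have "measure M ((A \<inter> B) \<times> {1}) \<le> measure M (A \<times> {1})"
        using AB by (intro finite_measure_mono class_sets) auto
      moreover have "measure M ((A \<inter> B) \<times> {-1}) \<le> measure M (B \<times> {-1})"
        using AB by (intro finite_measure_mono class_sets) auto
      moreover have "measure (distr M borel fst) (A \<inter> B) > 0"
        using x AB by auto
      ultimately show False
        using AB split[of "A \<inter> B"] by auto
    qed
  qed
qed

end

theory Submission
  imports Defs
begin

text \<open>
  The form \<open>B x x' = \<langle>Q x, Q x'\<rangle> - \<langle>x, x'\<rangle>\<close> is bilinear, so the bound \<open>\<bar>B\<bar> \<le> \<eta>\<close> extends from the support to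
  its convex hull. For \<open>u\<close> and \<open>v\<close> in the convex hulls of the two classes the margin gives
  \<open>\<parallel>u - v\<parallel>\<^sup>2 \<ge> 4 / \<parallel>w0\<parallel>\<^sup>2\<close>, while \<open>B (u - v) (u - v) = B u u - 2 B u v + B v v \<ge> - 4 \<eta>\<close>. Hence
  \<open>\<parallel>Q u - Q v\<parallel>\<^sup>2 \<ge> 4 (1 / \<parallel>w0\<parallel>\<^sup>2 - \<eta>) > 0\<close>: the hulls of the compressed classes are at positive
  distance, and a hyperplane separates them strongly.
\<close>

section \<open>Convex geometry: bounds on hulls and strong separation\<close>

lemma abs_linear_le_convex_hull:
  fixes f :: "'a::real_vector \<Rightarrow> real"
  assumes "linear f" and "\<And>x. x \<in> A \<Longrightarrow> \<bar>f x\<bar> \<le> \<eta>" and "x \<in> convex hull A"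
  shows "\<bar>f x\<bar> \<le> \<eta>"
proof -
  have "convex hull A \<subseteq> f -` {-\<eta>..\<eta>}"
  proof (rule hull_minimal)
    show "A \<subseteq> f -` {-\<eta>..\<eta>}"
      using assms(2) by (force simp: abs_le_iff)
    show "convex (f -` {-\<eta>..\<eta>})"
      by (intro convex_linear_vimage assms(1) convex_real_interval)
  qed
  with assms(3) show ?thesis
    by (force simp: abs_le_iff)
qed

text \<open>The linear case is applied twice: freezing one argument passes to the hull in the other,
  and then the roles are exchanged.\<close>

lemma abs_bilinear_le_convex_hull:
  fixes B :: "'a::real_vector \<Rightarrow> 'b::real_vector \<Rightarrow> real"
  assumes B: "bilinear B" and le: "\<And>x y. x \<in> S \<Longrightarrow> y \<in> T \<Longrightarrow> \<bar>B x y\<bar> \<le> \<eta>"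
    and x: "x \<in> convex hull S" and y: "y \<in> convex hull T"
  shows "\<bar>B x y\<bar> \<le> \<eta>"
proof -
  have "linear (B x')" "linear (\<lambda>z. B z y)" for x'
    using B by (simp_all add: bilinear_def)
  then show ?thesis
    using le x y by (meson abs_linear_le_convex_hull)
qed

text \<open>The set of differences is convex and keeps distance \<open>d\<close> from 0, so a
  hyperplane separates 0 from its closure with a gap. This replaces a compactness argument, since
  hulls of supports may be unbounded.\<close>

lemma strongly_separating_hyperplane:
  fixes S T :: "'a::euclidean_space set"
  assumes "convex S" "convex T" "d > 0"
    and dist: "\<And>u v. u \<in> S \<Longrightarrow> v \<in> T \<Longrightarrow> d \<le> norm (u - v)"
  obtains w b where "\<And>u. u \<in> S \<Longrightarrow> w \<bullet> u + b \<ge> 1" "\<And>v. v \<in> T \<Longrightarrow> w \<bullet> v + b \<le> -1"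
proof (cases "S = {} \<or> T = {}")
  case True
  \<comment> \<open>A constant functional suffices: -1 if \<open>S\<close> is empty, 1 if
    \<open>T\<close> is empty.\<close>
  then show ?thesis
    using that[of 0 "-1"] that[of 0 1] by auto
next
  case False
  define D where "D = (\<Union>u\<in>S. \<Union>v\<in>T. {u - v})"
  have "closure D \<subseteq> {z. d \<le> norm z}"
    using dist by (intro closure_minimal closed_Collect_le continuous_intros) (auto simp: D_def)
  then have "0 \<notin> closure D"
    using \<open>d > 0\<close> by auto
  moreover have "convex (closure D)"
    unfolding D_def using assms by (intro convex_closure convex_differences)
  ultimately obtain a c where c: "0 < c" "\<And>z. z \<in> closure D \<Longrightarrow> c < a \<bullet> z"
    using separating_hyperplane_closed_0[of "closure D"] by auto
  have gap: "a \<bullet> v + c \<le> a \<bullet> u" if "u \<in> S" "v \<in> T" for u v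
  proof -
    have "u - v \<in> closure D"
      using that closure_subset[of D] by (auto simp: D_def)
    then show ?thesis
      using c(2)[of "u - v"] by (simp add: inner_diff_right)
  qed
  \<comment> \<open>The threshold: \<open>a\<close> takes values at least \<open>t\<close> on
    \<open>S\<close> and at most \<open>t - c\<close> on \<open>T\<close>. Any point of
    \<open>T\<close> bounds the infimum from below.\<close>
  define t where "t = (INF u\<in>S. a \<bullet> u)"
  obtain v0 where "v0 \<in> T"
    using False by auto
  then have "bdd_below ((\<bullet>) a ` S)"
    using gap[of _ v0] by (intro bdd_belowI2)
  then have S: "t \<le> a \<bullet> u" if "u \<in> S" for u
    unfolding t_def using that by (rule cINF_lower)
  have T: "a \<bullet> v + c \<le> t" if "v \<in> T" for v
    unfolding t_def using that False gap by (intro cINF_greatest) auto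
  \<comment> \<open>The affine rescaling that sends the value \<open>t\<close> of \<open>a\<close>
    to 1 and the value \<open>t - c\<close> to -1.\<close>
  show ?thesis
  proof (rule that[of "(2 / c) *\<^sub>R a" "1 - 2 * t / c"])
    fix u assume "u \<in> S"
    then show "((2 / c) *\<^sub>R a) \<bullet> u + (1 - 2 * t / c) \<ge> 1"
      using S[of u] c(1) by (simp add: divide_simps)
  next
    fix v assume "v \<in> T"
    then have "1 \<le> (t - a \<bullet> v) / c"
      using T[of v] c(1) by simp
    moreover have "((2 / c) *\<^sub>R a) \<bullet> v + (1 - 2 * t / c) = 1 - 2 * ((t - a \<bullet> v) / c)"
      by (simp add: diff_divide_distrib)
    ultimately show "((2 / c) *\<^sub>R a) \<bullet> v + (1 - 2 * t / c) \<le> -1"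
      by linarith
  qed
qed

text \<open>Cauchy-Schwarz applied to \<open>w \<bullet> (u - v)\<close>, which is at least 2. The
  product form also covers \<open>w = 0\<close>, where it reads 4 \<le> 0 and exposes contradictory
  hypotheses.\<close>

lemma halfspace_distance:
  fixes w u v :: "'a::real_inner"
  assumes "w \<bullet> u + b \<ge> 1" and "w \<bullet> v + b \<le> -1"
  shows "4 \<le> (norm w)\<^sup>2 * (norm (u - v))\<^sup>2"
proof -
  have "2 \<le> w \<bullet> (u - v)"
    using assms by (simp add: inner_diff_right)
  also have "\<dots> \<le> norm w * norm (u - v)"
    by (rule norm_cauchy_schwarz)
  finally have "2\<^sup>2 \<le> (norm w * norm (u - v))\<^sup>2"
    by (intro power_mono) auto
  then show ?thesis
    by (simp add: power_mult_distrib)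
qed

lemma separation_under_inner_product_preserving_map:
  fixes f :: "'a::real_inner \<Rightarrow> 'b::euclidean_space"
  assumes f: "linear f"
    and preserving: "\<And>x x'. x \<in> S \<union> T \<Longrightarrow> x' \<in> S \<union> T \<Longrightarrow> \<bar>f x \<bullet> f x' - x \<bullet> x'\<bar> \<le> \<eta>"
    and S: "\<And>u. u \<in> S \<Longrightarrow> w0 \<bullet> u + b0 \<ge> 1" and T: "\<And>v. v \<in> T \<Longrightarrow> w0 \<bullet> v + b0 \<le> -1"
    and \<eta>: "\<eta> * (norm w0)\<^sup>2 < 1"
  obtains w b where "\<And>u. u \<in> S \<Longrightarrow> w \<bullet> f u + b \<ge> 1" "\<And>v. v \<in> T \<Longrightarrow> w \<bullet> f v + b \<le> -1"
proof -
  define B where "B = (\<lambda>x x'. f x \<bullet> f x' - x \<bullet> x')"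
  interpret f: linear f
    by (rule f)
  have bilinear: "bilinear B"
    unfolding B_def bilinear_def
    by (auto intro!: linearI simp: f.add f.scale inner_simps algebra_simps)
  have B_le: "\<bar>B x x'\<bar> \<le> \<eta>" if "x \<in> convex hull (S \<union> T)" "x' \<in> convex hull (S \<union> T)" for x x'
    using bilinear _ that by (rule abs_bilinear_le_convex_hull) (simp add: B_def preserving)
  have hull_S: "w0 \<bullet> u + b0 \<ge> 1" if "u \<in> convex hull S" for u
  proof -
    have "convex hull S \<subseteq> {u. w0 \<bullet> u \<ge> 1 - b0}"
      using S by (intro hull_minimal convex_halfspace_ge) (auto simp: algebra_simps)
    with that show ?thesis by auto
  qed
  have hull_T: "w0 \<bullet> v + b0 \<le> -1" if "v \<in> convex hull T" for v
  proof -
    have "convex hull T \<subseteq> {v. w0 \<bullet> v \<le> -1 - b0}"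
      using T by (intro hull_minimal convex_halfspace_le) (force simp: algebra_simps)
    with that show ?thesis by auto
  qed
  \<comment> \<open>For \<open>w0 = 0\<close> the two hulls cannot both be nonempty, so the distance
    bound is vacuous and 1 is an arbitrary positive choice; the formula would be unsuitable there,
    as 1 / 0 = 0 in \<open>real\<close>.\<close>
  define d where "d = (if w0 = 0 then 1 else sqrt (4 * (1 / (norm w0)\<^sup>2 - \<eta>)))"
  have "d > 0"
    using \<eta> by (auto simp: d_def field_simps)
  have dist: "d \<le> norm (f u - f v)" if u: "u \<in> convex hull S" and v: "v \<in> convex hull T" for u v
  proof -
    have margin: "4 \<le> (norm w0)\<^sup>2 * (norm (u - v))\<^sup>2"
      by (rule halfspace_distance[OF hull_S[OF u] hull_T[OF v]])
    then have "w0 \<noteq> 0"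
      by auto
    then have "4 / (norm w0)\<^sup>2 \<le> (norm (u - v))\<^sup>2"
      using margin by (simp add: field_simps)
    \<comment> \<open>The term \<open>B u v\<close> mixes the classes, so the bound is taken on the
      hull of the union, which contains both hulls.\<close>
    moreover have "u \<in> convex hull (S \<union> T)" "v \<in> convex hull (S \<union> T)"
      using u v hull_mono[of S "S \<union> T" convex] hull_mono[of T "S \<union> T" convex] by auto
    then have "\<bar>B u u\<bar> \<le> \<eta>" "\<bar>B u v\<bar> \<le> \<eta>" "\<bar>B v v\<bar> \<le> \<eta>"
      by (auto intro: B_le)
    moreover have "(norm (f u - f v))\<^sup>2 = (norm (u - v))\<^sup>2 + B u u - 2 * B u v + B v v"
      by (simp add: B_def power2_norm_eq_inner inner_simps inner_commute)
    ultimately have "4 * (1 / (norm w0)\<^sup>2 - \<eta>) \<le> (norm (f u - f v))\<^sup>2"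
      by (simp add: abs_le_iff)
    then show ?thesis
      using \<open>w0 \<noteq> 0\<close> by (simp add: d_def real_le_lsqrt)
  qed
  have conv: "convex (f ` (convex hull S))" "convex (f ` (convex hull T))"
    by (simp_all add: convex_linear_image f)
  have "d \<le> norm (u - v)" if "u \<in> f ` (convex hull S)" "v \<in> f ` (convex hull T)" for u v
    using that dist by auto
  then obtain w b where w: "\<And>u. u \<in> f ` (convex hull S) \<Longrightarrow> w \<bullet> u + b \<ge> 1"
    "\<And>v. v \<in> f ` (convex hull T) \<Longrightarrow> w \<bullet> v + b \<le> -1"
    using strongly_separating_hyperplane[OF conv \<open>d > 0\<close>] by metis
  show ?thesis
  proof (rule that)
    show "w \<bullet> f u + b \<ge> 1" if "u \<in> S" for u
      using that by (intro w imageI hull_inc)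
    show "w \<bullet> f v + b \<le> -1" if "v \<in> T" for v
      using that by (intro w imageI hull_inc)
  qed
qed

section \<open>Measure theory: margin events and class supports\<close>

context
  fixes M :: "((real ^ 'n) \<times> real) measure"
  assumes prob: "prob_space M" and sets: "sets M = sets labelled_borel"
begin

interpretation prob_space M
  by (rule prob)

lemma space_labelled: "space M = UNIV \<times> {-1, 1}"
  using sets_eq_imp_space_eq[OF sets] by (simp add: labelled_borel_def space_pair_measure)

lemma open_times_label_sets: "open A \<Longrightarrow> y \<in> {-1, 1} \<Longrightarrow> A \<times> {y} \<in> sets M"
  by (auto simp: sets labelled_borel_def intro!: pair_measureI)

lemma affine_margin_sets:
  "{z \<in> space M. case z of (x, y) \<Rightarrow> y * (w \<bullet> (A *v x) + b) \<ge> 1} \<in> sets M"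
proof -
  have [measurable]: "fst \<in> borel_measurable M"
    by (simp add: labelled_borel_def measurable_cong_sets[OF sets refl])
  have "snd \<in> labelled_borel \<rightarrow>\<^sub>M count_space {-1, 1 :: real}"
    by (simp add: labelled_borel_def)
  then have "snd \<in> M \<rightarrow>\<^sub>M count_space {-1, 1 :: real}"
    by (simp add: measurable_cong_sets[OF sets refl])
  \<comment> \<open>The labels carry the discrete sigma-algebra; composing with the identity,
    measurable from a discrete space, makes \<open>snd\<close> a Borel function.\<close>
  from measurable_compose[OF this, of "\<lambda>y. y" borel] have [measurable]: "snd \<in> borel_measurable M"
    by simp
  have "continuous_on UNIV (\<lambda>x. w \<bullet> (A *v x))"
    by (intro continuous_intros linear_continuous_on linear_conv_bounded_linear[THEN iffD1] matrix_vector_mul_linear)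
  then have [measurable]: "(\<lambda>x. w \<bullet> (A *v x)) \<in> borel_measurable borel"
    by (rule borel_measurable_continuous_onI)
  have "{z \<in> space M. snd z * (w \<bullet> (A *v fst z) + b) \<ge> 1} \<in> sets M"
    by measurable
  then show ?thesis
    by (simp add: case_prod_beta)
qed

text \<open>The matrix is a parameter so that \<open>A = mat 1\<close> treats the given separation
  and \<open>A = Q\<close> the compressed one.\<close>

lemma prob_affine_margin_eq_1_iff:
  "\<P>((x, y) in M. y * (w \<bullet> (A *v x) + b) \<ge> 1) = 1 \<longleftrightarrow>
    (AE (x, y) in M. y * (w \<bullet> (A *v x) + b) \<ge> 1)"
proof -
  have "{(x, y). (x, y) \<in> space M \<and> y * (w \<bullet> (A *v x) + b) \<ge> 1} =
      {z \<in> space M. case z of (x, y) \<Rightarrow> y * (w \<bullet> (A *v x) + b) \<ge> 1}"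
    by auto
  then show ?thesis
    by (simp only: prob_Collect_eq_1[OF affine_margin_sets])
qed

text \<open>A point outside \<open>C\<close> has the open neighbourhood \<open>- C\<close>, which is
  null for the label \<open>y\<close>. This turns an almost sure closed condition into one valid at
  every support point.\<close>

lemma class_support_subset_closed:
  assumes "closed C" "y \<in> {-1, 1}" and AE: "AE (x, y') in M. y' = y \<longrightarrow> x \<in> C"
  shows "class_support M y \<subseteq> C"
proof (rule ccontr)
  assume "\<not> class_support M y \<subseteq> C"
  then obtain x where "x \<in> class_support M y" "x \<in> - C"
    by auto
  then have "measure M ((- C) \<times> {y}) > 0"
    using \<open>closed C\<close> by (auto simp: class_support_def)
  moreover have "(- C) \<times> {y} \<in> null_sets M"
    using AE assms(1,2) by (subst AE_iff_null_sets) (auto elim: eventually_mono intro!: open_times_label_sets)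
  ultimately show False
    by (simp add: measure_eq_0_null_sets)
qed

text \<open>The complement of a class support is a union of open sets that are null for that label.
  By Lindelof countably many of them cover it, so it is null as well.\<close>

lemma AE_class_support: "AE (x, y) in M. x \<in> class_support M y"
proof -
  have "AE (x, y') in M. y' = y \<longrightarrow> x \<in> class_support M y" if y: "y \<in> {-1, 1}" for y
  proof -
    define F where "F = {A. open A \<and> measure M (A \<times> {y}) = 0}"
    have Un: "\<Union>F = - class_support M y"
      using measure_nonneg[of M] by (force simp: F_def class_support_def less_le)
    obtain F' where F': "F' \<subseteq> F" "countable F'" "\<Union>F' = \<Union>F"
      by (rule Lindelof[of F]) (auto simp: F_def)
    have "(\<Union>A\<in>F'. A \<times> {y}) \<in> null_sets M"
    proof (rule null_sets_UN'[OF F'(2)])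
      fix A assume "A \<in> F'"
      then show "A \<times> {y} \<in> null_sets M"
        using F'(1) y by (auto simp: F_def null_sets_def emeasure_eq_measure intro: open_times_label_sets)
    qed
    also have "(\<Union>A\<in>F'. A \<times> {y}) = (- class_support M y) \<times> {y}"
      using F'(3) Un by auto
    finally show ?thesis
      by (rule AE_I'[OF _ ]) auto
  qed
  from this[of 1, simplified] this[of "-1", simplified] AE_space show ?thesis
    by eventually_elim (auto simp: space_labelled)
qed

end

section \<open>Back to the distribution: unpacking the hypotheses and conclusion\<close>

lemma inner_product_preservingD:
  assumes "inner_product_preserving \<eta> A Q" "x \<in> A" "x' \<in> A"
  shows "\<bar>(Q *v x) \<bullet> (Q *v x') - x \<bullet> x'\<bar> \<le> \<eta>"
  using assms unfolding inner_product_preserving_def SUP_le_iff by force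

text \<open>In \<open>ereal\<close> 1 / 0 is infinite, in \<open>real\<close> it is 0. The product
  form transfers the bound safely: for \<open>r = 0\<close> it reads 0 < 1.\<close>

lemma less_inverse_ereal_imp_mult_less_1:
  assumes "ereal \<eta> < 1 / ereal r" and "r \<ge> 0"
  shows "\<eta> * r < 1"
proof (cases "r = 0")
  case False
  then have "1 / ereal r = ereal (1 / r)"
    by (simp add: one_ereal_def)
  then show ?thesis
    using assms False by (simp add: field_simps)
qed simp

theorem theorem1:
  fixes \<mu> :: "((real ^ 'n) \<times> real) measure"
    and w0 :: "real ^ 'n" and b0 :: real
    and Q :: "real ^ 'n ^ 'm" and \<eta> :: real
  assumes "prob_space \<mu>"
    and "sets \<mu> = sets labelled_borel"
    and "\<P>((x, y) in \<mu>. y * (w0 \<bullet> x + b0) \<ge> 1) = 1"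
    and "inner_product_preserving \<eta> (data_support \<mu>) Q"
    and "ereal \<eta> < 1 / ereal ((norm w0)\<^sup>2)"
  shows "\<exists>(w' :: real ^ 'm) (b' :: real).
           \<P>((x, y) in \<mu>. y * (w' \<bullet> (Q *v x) + b') \<ge> 1) = 1"
proof -
  note M = assms(1,2)
  have sep: "AE (x, y) in \<mu>. y * (w0 \<bullet> x + b0) \<ge> 1"
    using assms(3) prob_affine_margin_eq_1_iff[OF M, of w0 "mat 1" b0] by simp
  have closed: "closed {x. y * (w0 \<bullet> x + b0) \<ge> 1}" for y
    by (intro closed_Collect_le continuous_intros)
  \<comment> \<open>The margin holds only almost surely, but the half-spaces are closed, so it holds
    on the whole class support.\<close>
  have support: "class_support \<mu> y \<subseteq> {x. y * (w0 \<bullet> x + b0) \<ge> 1}" if "y \<in> {-1, 1}" for y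
    using sep by (intro class_support_subset_closed[OF M closed that]) (auto elim: eventually_mono)
  have preserving: "\<bar>(Q *v x) \<bullet> (Q *v x') - x \<bullet> x'\<bar> \<le> \<eta>"
    if "x \<in> class_support \<mu> 1 \<union> class_support \<mu> (-1)"
      "x' \<in> class_support \<mu> 1 \<union> class_support \<mu> (-1)" for x x'
    using inner_product_preservingD[OF assms(4)] that by (simp add: data_support_def)
  have "w0 \<bullet> u + b0 \<ge> 1" if "u \<in> class_support \<mu> 1" for u
    using support[of 1] that by auto
  moreover have "w0 \<bullet> v + b0 \<le> -1" if "v \<in> class_support \<mu> (-1)" for v
    using support[of "-1"] that by force
  moreover have "\<eta> * (norm w0)\<^sup>2 < 1"
    using assms(5) by (rule less_inverse_ereal_imp_mult_less_1) simp
  ultimately obtain w b where pos: "\<And>u. u \<in> class_support \<mu> 1 \<Longrightarrow> w \<bullet> (Q *v u) + b \<ge> 1"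
    and neg: "\<And>v. v \<in> class_support \<mu> (-1) \<Longrightarrow> w \<bullet> (Q *v v) + b \<le> -1"
    using separation_under_inner_product_preserving_map[where S = "class_support \<mu> 1" and
        T = "class_support \<mu> (-1)", OF matrix_vector_mul_linear[of Q] preserving]
    by metis
  \<comment> \<open>Almost every labelled point lies in the support of its own class, where
    \<open>pos\<close> or \<open>neg\<close> applies according to the label.\<close>
  have "AE (x, y) in \<mu>. y * (w \<bullet> (Q *v x) + b) \<ge> 1"
    using AE_class_support[OF M] AE_space
    by eventually_elim (use pos neg in \<open>force simp: space_labelled[OF M]\<close>)
  then show ?thesis
    using prob_affine_margin_eq_1_iff[OF M] by blast
qed

end
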